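(* Let $(\Omega,\mathbb{F})$ be a measurable space, let $P_n$, $n=1,2,\ldots$, be a sequence of probability measures on $(\Omega,\mathbb{F})$ that converges in total variation to a probability measure $P$ on $(\Omega,\mathbb{F})$, and let $\mathbb{A}$, $\mathbb{B}$, and $\mathbb{H}$ be sub-$\sigma$-algebras of $\mathbb{F}$. If $\mathbb{A}$ and $\mathbb{B}$ are conditionally independent given $\mathbb{H}$ with respect to $P_n$ for all $n$, then $\mathbb{A}$ and $\mathbb{B}$ are conditionally independent given $\mathbb{H}$ with respect to $P$.
   Context: Probability measures are $\sigma$-additive. For probability measures $P,Q$ on $(\Omega,\mathbb{F})$, the total variation norm of the difference is $\Vert P-Q\Vert_\infty=\sup_{F\in\mathbb{F}}|P(F)-Q(F)|$; $P_n$ converges in total variation to $P$ if $\Vert P_n-P\Vert_\infty\to 0$ as $n\to\infty$. For a probability measure $Q$ on $(\Omega,\mathbb{F})$, a sub-$\sigma$-algebra $\mathbb{H}\subseteq\mathbb{F}$ and $A\in\mathbb{F}$, the conditional probability $Q(A\,|\,\mathbb{H})$ is the conditional expectation under $Q$ of the indicator function $\mathbf{1}_A$ given $\mathbb{H}$. Sub-$\sigma$-algebras $\mathbb{A},\mathbb{B}\subseteq\mathbb{F}$ are conditionally independent given $\mathbb{H}$ with respect to $Q$ if for all $A\in\mathbb{A}$ and $B\in\mathbb{B}$, $Q(A\cap B\,|\,\mathbb{H})=Q(A\,|\,\mathbb{H})\,Q(B\,|\,\mathbb{H})$ $Q$-almost surely. *)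

theory Defs
  imports "HOL-Probability.Probability"
begin

(* sup over the common sigma-algebra; only meaningful for P, Q with sets P = sets Q.
   For probability measures the set of values is nonempty and bounded by 1, so the
   real-valued supremum is the genuine one. *)
definition tv_norm_diff :: "'a measure \<Rightarrow> 'a measure \<Rightarrow> real" where
  "tv_norm_diff P Q = (SUP E\<in>sets P. \<bar>measure P E - measure Q E\<bar>)"

definition converges_in_tv :: "(nat \<Rightarrow> 'a measure) \<Rightarrow> 'a measure \<Rightarrow> bool" where
  "converges_in_tv Pn P \<longleftrightarrow> (\<lambda>n. tv_norm_diff (Pn n) P) \<longlonglongrightarrow> 0"

(* As in the theory of conditional expectations, a sub-sigma-algebra of Q is a measure H
   with subalgebra Q H; only its space and sets matter, its measure is irrelevant.
   real_cond_exp is one fixed version of the conditional expectation. *)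
definition cond_prob_given :: "'a measure \<Rightarrow> 'a measure \<Rightarrow> 'a set \<Rightarrow> 'a \<Rightarrow> real" where
  "cond_prob_given Q H E = real_cond_exp Q H (indicator E)"

definition cond_indep_given ::
    "'a measure \<Rightarrow> 'a measure \<Rightarrow> 'a measure \<Rightarrow> 'a measure \<Rightarrow> bool" where
  "cond_indep_given Q A B H \<longleftrightarrow>
     (\<forall>E\<in>sets A. \<forall>D\<in>sets B. AE x in Q.
        cond_prob_given Q H (E \<inter> D) x = cond_prob_given Q H E x * cond_prob_given Q H D x)"

end

theory Submission
  imports Defs
begin

text \<open>
  Conditional independence says that a certain function built from three conditional probabilities
  vanishes almost surely, so it suffices that its \<open>L\<^sup>1(P)\<close> norm is the limit of quantities that
  are zero. Two estimates do this. Write \<open>\<delta>\<close> for the total variation distance between \<open>Q\<close> and \<open>P\<close>.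

  First, expectations of functions with values in \<open>[0, 1]\<close> under \<open>P\<close> and \<open>Q\<close> differ by at most \<open>\<delta>\<close>
  (\<open>expectation_diff_le_tv_norm_diff\<close>), hence those of functions with values in \<open>[-1, 1]\<close> by at
  most \<open>2\<delta>\<close>.

  Secondly, the conditional probabilities \<open>u\<close>, \<open>v\<close> of an event \<open>E\<close> under \<open>Q\<close> and \<open>P\<close> have distance
  at most \<open>2\<delta>\<close> in \<open>L\<^sup>1(P)\<close> (\<open>clipped_cond_prob_L1_dist\<close>). The sign \<open>s\<close> of \<open>u - v\<close> is measurable
  with respect to the conditioning \<open>\<sigma>\<close>-algebra. Conditioning therefore turns the \<open>P\<close>-expectation
  of \<open>\<bar>u - v\<bar> = s (u - v)\<close> into that of \<open>s (u - 1\<^sub>E)\<close>. The latter function has values in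
  \<open>[-1, 1]\<close> and has \<open>Q\<close>-expectation zero.

  Now let \<open>a\<close>, \<open>b\<close>, \<open>c\<close> be the conditional probabilities of \<open>E\<close>, \<open>D\<close>, \<open>E \<inter> D\<close> under \<open>P\<close>, and
  \<open>a'\<close>, \<open>b'\<close>, \<open>c'\<close> those under \<open>Q = P\<^sub>n\<close>. Since
  \[ \<bar>c - a b\<bar> \<le> \<bar>c' - c\<bar> + \<bar>c' - a' b'\<bar> + \<bar>a' - a\<bar> + \<bar>b' - b\<bar> \]
  and the second summand has \<open>Q\<close>-expectation zero, the \<open>P\<close>-expectation of \<open>\<bar>c - a b\<bar>\<close> is at most
  \<open>2\<delta> + \<delta> + 2\<delta> + 2\<delta> = 7\<delta>\<close>, which tends to zero along the sequence.

  A version of a conditional probability under \<open>Q\<close> need only lie in \<open>[0, 1]\<close> up to a set that is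
  null for \<open>Q\<close>, and such a set may have positive measure under \<open>P\<close>. For this reason all estimates
  are made for versions clipped to \<open>[0, 1]\<close>.
\<close>

section \<open>Expectations of bounded functions and total variation\<close>

text \<open>
  Rounding \<open>y\<close> down to a multiple of \<open>1/k\<close> amounts to counting the levels \<open>j/k\<close> below \<open>y\<close>. Applied
  to the values of a function, this approximates it uniformly by an average of indicator functions
  of its superlevel sets.
\<close>

lemma staircase_bounds:
  fixes y :: real and k :: nat
  assumes "k > 0" "0 \<le> y" "y \<le> 1"
  defines "s \<equiv> (\<Sum>j\<in>{1..k}. of_bool (real j / real k \<le> y)) / real k"
  shows "s \<le> y" "y \<le> s + 1 / real k"
proof -
  have "{j \<in> {1..k}. real j / real k \<le> y} = {1..nat \<lfloor>real k * y\<rfloor>}" (is "?J = _")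
  proof (rule set_eqI)
    fix j
    have "real k * y \<le> real k"
      using assms by (simp add: mult_left_le)
    moreover have "real j / real k \<le> y \<longleftrightarrow> real j \<le> real k * y"
      using assms by (simp add: field_simps)
    moreover have "j \<le> nat \<lfloor>real k * y\<rfloor> \<longleftrightarrow> real j \<le> real k * y"
      using assms by (simp add: le_nat_iff le_floor_iff)
    ultimately show "j \<in> ?J \<longleftrightarrow> j \<in> {1..nat \<lfloor>real k * y\<rfloor>}"
      by auto
  qed
  moreover have "(\<Sum>j\<in>{1..k}. of_bool (real j / real k \<le> y)) = real (card ?J)"
    by (simp add: of_bool_def sum.If_cases Int_def)
  ultimately have "s = of_int \<lfloor>real k * y\<rfloor> / real k"
    using assms by (simp add: s_def)
  moreover have "of_int \<lfloor>real k * y\<rfloor> \<le> real k * y" "real k * y \<le> of_int \<lfloor>real k * y\<rfloor> + 1"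
    by linarith+
  ultimately show "s \<le> y" "y \<le> s + 1 / real k"
    using assms by (simp_all add: field_simps)
qed

lemma expectation_le_add_if_measure_le_add:
  fixes f :: "'a \<Rightarrow> real"
  assumes "prob_space M" "prob_space N" and sets_eq: "sets M = sets N"
    and le: "\<And>E. E \<in> sets N \<Longrightarrow> measure M E \<le> measure N E + \<delta>"
    and f [measurable]: "f \<in> borel_measurable N"
    and bounds: "\<And>x. 0 \<le> f x" "\<And>x. f x \<le> 1"
  shows "(\<integral>x. f x \<partial>M) \<le> (\<integral>x. f x \<partial>N) + \<delta>"
proof -
  interpret M: prob_space M by fact
  interpret N: prob_space N by fact
  have space_eq: "space M = space N"
    using sets_eq by (rule sets_eq_imp_space_eq)
  have fM [measurable]: "f \<in> borel_measurable M"
    using f by (simp add: measurable_def space_eq sets_eq)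
  have int_f: "integrable M f" "integrable N f"
    by (rule M.integrable_const_bound[where B=1] N.integrable_const_bound[where B=1];
        simp add: bounds)+
  have approx: "(\<integral>x. f x \<partial>M) \<le> (\<integral>x. f x \<partial>N) + \<delta> + 1 / real k" if k: "k > 0" for k :: nat
  proof -
    define S where "S j = {x \<in> space N. real j / real k \<le> f x}" for j
    define s where "s x = (\<Sum>j\<in>{1..k}. indicator (S j) x) / real k" for x
    have [measurable]: "S j \<in> sets N" "S j \<in> sets M" for j
      unfolding S_def sets_eq by measurable
    have int_s: "integrable M s" "(\<integral>x. s x \<partial>M) = (\<Sum>j\<in>{1..k}. measure M (S j)) / real k"
      "integrable N s" "(\<integral>x. s x \<partial>N) = (\<Sum>j\<in>{1..k}. measure N (S j)) / real k"
      unfolding s_def by (simp_all add: less_top[symmetric])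
    have s_eq: "s x = (\<Sum>j\<in>{1..k}. of_bool (real j / real k \<le> f x)) / real k"
      if "x \<in> space N" for x
      using that by (simp add: s_def S_def indicator_def)
    have below: "s x \<le> f x" and above: "f x \<le> s x + 1 / real k" if "x \<in> space N" for x
      using staircase_bounds[OF k bounds(1,2), of x] s_eq[OF that] by simp_all
    have "(\<integral>x. f x \<partial>M) \<le> (\<integral>x. s x + 1 / real k \<partial>M)"
      using int_f int_s above by (intro integral_mono) (auto simp: space_eq)
    also have "\<dots> = (\<Sum>j\<in>{1..k}. measure M (S j)) / real k + 1 / real k"
      using int_s by (simp add: M.prob_space)
    also have "\<dots> \<le> (\<Sum>j\<in>{1..k}. measure N (S j) + \<delta>) / real k + 1 / real k"
      by (intro add_right_mono divide_right_mono sum_mono le) auto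
    also have "\<dots> = (\<integral>x. s x \<partial>N) + \<delta> + 1 / real k"
      using k int_s(4) by (simp add: sum.distrib add_divide_distrib)
    also have "(\<integral>x. s x \<partial>N) \<le> (\<integral>x. f x \<partial>N)"
      using int_f int_s below by (intro integral_mono) auto
    finally show ?thesis by simp
  qed
  show ?thesis
  proof (rule LIMSEQ_le_const)
    show "(\<lambda>k. (\<integral>x. f x \<partial>N) + \<delta> + 1 / real k) \<longlonglongrightarrow> (\<integral>x. f x \<partial>N) + \<delta>"
      using tendsto_add[OF tendsto_const lim_1_over_n] by simp
    show "\<exists>K. \<forall>k\<ge>K. (\<integral>x. f x \<partial>M) \<le> (\<integral>x. f x \<partial>N) + \<delta> + 1 / real k"
      using approx by (intro exI[of _ 1]) auto
  qed
qed

lemma measure_diff_le_tv_norm_diff: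
  assumes "prob_space P" "prob_space Q" "E \<in> sets P"
  shows "\<bar>measure P E - measure Q E\<bar> \<le> tv_norm_diff P Q"
  unfolding tv_norm_diff_def
proof (rule cSUP_upper[OF assms(3)], rule bdd_aboveI2)
  fix E
  have "0 \<le> measure P E" "measure P E \<le> 1" "0 \<le> measure Q E" "measure Q E \<le> 1"
    using assms by (simp_all add: prob_space.prob_le_1)
  then show "\<bar>measure P E - measure Q E\<bar> \<le> 1"
    by linarith
qed

lemma expectation_diff_le_tv_norm_diff:
  fixes f :: "'a \<Rightarrow> real"
  assumes P: "prob_space P" and Q: "prob_space Q" and sets_eq: "sets P = sets Q"
    and f: "f \<in> borel_measurable P" and bounds: "\<And>x. 0 \<le> f x" "\<And>x. f x \<le> 1"
  shows "\<bar>(\<integral>x. f x \<partial>P) - (\<integral>x. f x \<partial>Q)\<bar> \<le> tv_norm_diff P Q"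
proof -
  have fQ: "f \<in> borel_measurable Q"
    using f by (simp add: measurable_cong_sets[OF sets_eq refl])
  have "measure P E \<le> measure Q E + tv_norm_diff P Q"
    "measure Q E \<le> measure P E + tv_norm_diff P Q" if "E \<in> sets P" for E
    using measure_diff_le_tv_norm_diff[OF P Q that] by linarith+
  then have "(\<integral>x. f x \<partial>P) \<le> (\<integral>x. f x \<partial>Q) + tv_norm_diff P Q"
    "(\<integral>x. f x \<partial>Q) \<le> (\<integral>x. f x \<partial>P) + tv_norm_diff P Q"
    using expectation_le_add_if_measure_le_add[OF P Q sets_eq _ fQ bounds]
      expectation_le_add_if_measure_le_add[OF Q P sets_eq[symmetric] _ f bounds]
    by (simp_all add: sets_eq)
  then show ?thesis
    by linarith
qed

lemma expectation_diff_le_twice_tv_norm_diff: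
  fixes f :: "'a \<Rightarrow> real"
  assumes P: "prob_space P" and Q: "prob_space Q" and sets_eq: "sets P = sets Q"
    and f [measurable]: "f \<in> borel_measurable P" and bound: "\<And>x. \<bar>f x\<bar> \<le> 1"
  shows "\<bar>(\<integral>x. f x \<partial>P) - (\<integral>x. f x \<partial>Q)\<bar> \<le> 2 * tv_norm_diff P Q"
proof -
  interpret P: prob_space P by fact
  interpret Q: prob_space Q by fact
  have [measurable]: "f \<in> borel_measurable Q"
    using f by (simp add: measurable_cong_sets[OF sets_eq refl])
  have int: "integrable P f" "integrable Q f"
    by (rule P.integrable_const_bound[where B=1] Q.integrable_const_bound[where B=1];
        simp add: bound)+
  have "0 \<le> (f x + 1) / 2" "(f x + 1) / 2 \<le> 1" for x
    using bound[of x] by (simp_all add: abs_le_iff)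
  then have "\<bar>(\<integral>x. (f x + 1) / 2 \<partial>P) - (\<integral>x. (f x + 1) / 2 \<partial>Q)\<bar> \<le> tv_norm_diff P Q"
    by (intro expectation_diff_le_tv_norm_diff[OF P Q sets_eq]) simp_all
  then show ?thesis
    using int by (simp add: P.prob_space Q.prob_space field_simps)
qed

section \<open>Stability of conditional probabilities\<close>

definition clipped_cond_prob :: "'a measure \<Rightarrow> 'a measure \<Rightarrow> 'a set \<Rightarrow> 'a \<Rightarrow> real" where
  "clipped_cond_prob Q H E x = max 0 (min 1 (cond_prob_given Q H E x))"

lemma clipped_cond_prob_bounds:
  "0 \<le> clipped_cond_prob Q H E x" "clipped_cond_prob Q H E x \<le> 1"
  by (simp_all add: clipped_cond_prob_def)

lemma measurable_clipped_cond_prob: "clipped_cond_prob Q H E \<in> borel_measurable H"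
  unfolding clipped_cond_prob_def cond_prob_given_def by measurable

lemma sigma_finite_subalgebra_prob_space:
  assumes "prob_space Q" "subalgebra Q H"
  shows "sigma_finite_subalgebra Q H"
proof -
  interpret prob_space Q by fact
  show ?thesis
    using assms(2) by (intro finite_measure_subalgebra_is_sigma_finite) unfold_locales
qed

lemma AE_clipped_cond_prob_eq:
  assumes Q: "prob_space Q" and H: "subalgebra Q H" and E: "E \<in> sets Q"
  shows "AE x in Q. clipped_cond_prob Q H E x = cond_prob_given Q H E x"
proof -
  interpret prob_space Q by fact
  interpret sigma_finite_subalgebra Q H
    using Q H by (rule sigma_finite_subalgebra_prob_space)
  have int: "integrable Q (indicator E :: _ \<Rightarrow> real)"
    using E by (simp add: less_top[symmetric])
  have "AE x in Q. 0 \<le> cond_prob_given Q H E x" "AE x in Q. cond_prob_given Q H E x \<le> 1"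
    unfolding cond_prob_given_def
    by (rule real_cond_exp_ge_c[OF int] real_cond_exp_le_c[OF int], simp add: indicator_def)+
  then show ?thesis
    by eventually_elim (simp add: clipped_cond_prob_def)
qed

lemma integral_mult_clipped_cond_prob:
  fixes g :: "'a \<Rightarrow> real"
  assumes Q: "prob_space Q" and H: "subalgebra Q H" and E [measurable]: "E \<in> sets Q"
    and g: "g \<in> borel_measurable H" and bound: "\<And>x. \<bar>g x\<bar> \<le> 1"
  shows "(\<integral>x. g x * clipped_cond_prob Q H E x \<partial>Q) = (\<integral>x. g x * indicator E x \<partial>Q)"
proof -
  interpret prob_space Q by fact
  interpret sigma_finite_subalgebra Q H
    using Q H by (rule sigma_finite_subalgebra_prob_space)
  have [measurable]: "g \<in> borel_measurable Q" "clipped_cond_prob Q H E \<in> borel_measurable Q"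
    using H g measurable_clipped_cond_prob by (auto intro: measurable_from_subalg)
  have "(\<integral>x. g x * clipped_cond_prob Q H E x \<partial>Q) = (\<integral>x. g x * cond_prob_given Q H E x \<partial>Q)"
    using AE_clipped_cond_prob_eq[OF Q H E]
    by (intro integral_cong_AE) (auto simp: cond_prob_given_def)
  also have "integrable Q (\<lambda>x. g x * indicator E x)"
    using bound by (intro integrable_const_bound[where B=1]) (auto simp: indicator_def)
  then have "(\<integral>x. g x * cond_prob_given Q H E x \<partial>Q) = (\<integral>x. g x * indicator E x \<partial>Q)"
    unfolding cond_prob_given_def using g by (intro real_cond_exp_intg(2)) simp_all
  finally show ?thesis .
qed

text \<open>
  Testing the difference of the two conditional probabilities against its own sign, which is a
  function measurable for \<open>H\<close>, makes the defining property of conditional expectations applicable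
  under both measures.
\<close>

lemma clipped_cond_prob_L1_dist:
  assumes Q: "prob_space Q" and P: "prob_space P" and sets_eq: "sets Q = sets P"
    and H: "subalgebra P H" and E [measurable]: "E \<in> sets P"
  shows "(\<integral>x. \<bar>clipped_cond_prob Q H E x - clipped_cond_prob P H E x\<bar> \<partial>P)
    \<le> 2 * tv_norm_diff Q P"
proof -
  interpret P: prob_space P by fact
  interpret Q: prob_space Q by fact
  have HQ: "subalgebra Q H"
    using H sets_eq sets_eq_imp_space_eq[OF sets_eq] by (simp add: subalgebra_def)
  define u where "u = clipped_cond_prob Q H E"
  define v where "v = clipped_cond_prob P H E"
  define s where "s x = sgn (u x - v x)" for x
  have mH [measurable]: "u \<in> borel_measurable H" "v \<in> borel_measurable H"
    unfolding u_def v_def by (rule measurable_clipped_cond_prob)+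
  have sH: "s \<in> borel_measurable H"
    unfolding s_def by measurable
  have [measurable]: "E \<in> sets Q"
    by (simp add: sets_eq)
  have [measurable]: "u \<in> borel_measurable P" "v \<in> borel_measurable P" "s \<in> borel_measurable P"
    "u \<in> borel_measurable Q" "s \<in> borel_measurable Q"
    by (rule measurable_from_subalg[OF H] measurable_from_subalg[OF HQ], fact)+
  have bounds: "0 \<le> u x" "u x \<le> 1" "0 \<le> v x" "v x \<le> 1" "\<bar>s x\<bar> \<le> 1" for x
    by (simp_all add: u_def v_def s_def clipped_cond_prob_bounds sgn_real_def)
  have prod_le: "\<bar>s x * t\<bar> \<le> 1" if "\<bar>t\<bar> \<le> 1" for x t
    using mult_mono[OF bounds(5)[of x] that] by (simp add: abs_mult)
  have int: "integrable P (\<lambda>x. s x * u x)" "integrable P (\<lambda>x. s x * v x)"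
    "integrable P (\<lambda>x. s x * indicator E x)"
    "integrable Q (\<lambda>x. s x * u x)" "integrable Q (\<lambda>x. s x * indicator E x)"
    by (rule P.integrable_const_bound[where B=1] Q.integrable_const_bound[where B=1];
        simp add: prod_le bounds indicator_def)+
  have "(\<integral>x. \<bar>u x - v x\<bar> \<partial>P) = (\<integral>x. s x * u x - s x * v x \<partial>P)"
    by (intro Bochner_Integration.integral_cong refl) (auto simp: s_def sgn_real_def)
  also have "\<dots> = (\<integral>x. s x * u x \<partial>P) - (\<integral>x. s x * indicator E x \<partial>P)"
    using int integral_mult_clipped_cond_prob[OF P H E sH bounds(5)] by (simp add: v_def)
  also have "\<dots> = (\<integral>x. s x * (u x - indicator E x) \<partial>P)"
    using int by (simp add: right_diff_distrib)
  also have "\<dots> \<le> (\<integral>x. s x * (u x - indicator E x) \<partial>Q) + 2 * tv_norm_diff Q P"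
  proof -
    have "\<bar>u x - indicator E x\<bar> \<le> 1" for x
      using bounds(1,2)[of x] by (auto simp: indicator_def)
    then have "\<bar>(\<integral>x. s x * (u x - indicator E x) \<partial>Q) - (\<integral>x. s x * (u x - indicator E x) \<partial>P)\<bar>
      \<le> 2 * tv_norm_diff Q P"
      by (intro expectation_diff_le_twice_tv_norm_diff[OF Q P sets_eq] prod_le) measurable
    then show ?thesis
      by linarith
  qed
  also have "(\<integral>x. s x * (u x - indicator E x) \<partial>Q) = 0"
    using int integral_mult_clipped_cond_prob[OF Q HQ \<open>E \<in> sets Q\<close> sH bounds(5)]
    by (simp add: right_diff_distrib u_def)
  finally show ?thesis
    by (simp add: u_def v_def)
qed

section \<open>Conditional independence in the limit\<close>

text \<open>
  The \<open>L\<^sup>1(P)\<close> norm below measures how far \<open>E\<close> and \<open>D\<close> are from being conditionally independent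
  under \<open>P\<close>; replacing each of the three conditional probabilities by its counterpart under \<open>Q\<close>
  costs \<open>2\<delta>\<close>, and replacing \<open>P\<close> by \<open>Q\<close> in the remaining expectation costs one more \<open>\<delta>\<close>.
\<close>

lemma cond_indep_defect_le_tv_norm_diff:
  assumes Q: "prob_space Q" and P: "prob_space P" and sets_eq: "sets Q = sets P"
    and H: "subalgebra P H" and E: "E \<in> sets P" and D: "D \<in> sets P"
    and indep: "AE x in Q. cond_prob_given Q H (E \<inter> D) x
      = cond_prob_given Q H E x * cond_prob_given Q H D x"
  shows "(\<integral>x. \<bar>clipped_cond_prob P H (E \<inter> D) x
      - clipped_cond_prob P H E x * clipped_cond_prob P H D x\<bar> \<partial>P) \<le> 7 * tv_norm_diff Q P"
proof -
  interpret P: prob_space P by fact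
  have HQ: "subalgebra Q H"
    using H sets_eq sets_eq_imp_space_eq[OF sets_eq] by (simp add: subalgebra_def)
  have ED: "E \<inter> D \<in> sets P"
    using E D by blast
  define p where "p = clipped_cond_prob P H"
  define q where "q = clipped_cond_prob Q H"
  have [measurable]: "p G \<in> borel_measurable P" "q G \<in> borel_measurable P"
    "q G \<in> borel_measurable Q" for G
    unfolding p_def q_def
    using H HQ measurable_clipped_cond_prob by (auto intro: measurable_from_subalg)
  have bounds: "0 \<le> p G x" "p G x \<le> 1" "0 \<le> q G x" "q G x \<le> 1" for G x
    by (simp_all add: p_def q_def clipped_cond_prob_bounds)
  have prod_bounds: "0 \<le> p G x * p G' x" "p G x * p G' x \<le> 1"
    "0 \<le> q G x * q G' x" "q G x * q G' x \<le> 1" for G G' x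
    by (simp_all add: bounds mult_le_one)
  have diff_le: "\<bar>q G x - p G x\<bar> \<le> 1" "\<bar>p (E \<inter> D) x - p E x * p D x\<bar> \<le> 1"
    "\<bar>q (E \<inter> D) x - q E x * q D x\<bar> \<le> 1" for G x
    using bounds[of G x] bounds[of "E \<inter> D" x] prod_bounds[of E x D] by linarith+
  have int: "integrable P (\<lambda>x. \<bar>q G x - p G x\<bar>)"
    "integrable P (\<lambda>x. \<bar>p (E \<inter> D) x - p E x * p D x\<bar>)"
    "integrable P (\<lambda>x. \<bar>q (E \<inter> D) x - q E x * q D x\<bar>)" for G
    by (rule P.integrable_const_bound[where B=1]; simp add: diff_le)+
  have dist: "(\<integral>x. \<bar>q G x - p G x\<bar> \<partial>P) \<le> 2 * tv_norm_diff Q P" if "G \<in> sets P" for G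
    unfolding p_def q_def using Q P sets_eq H that by (rule clipped_cond_prob_L1_dist)
  have triangle: "\<bar>p (E \<inter> D) x - p E x * p D x\<bar>
    \<le> \<bar>q (E \<inter> D) x - p (E \<inter> D) x\<bar> + \<bar>q (E \<inter> D) x - q E x * q D x\<bar>
      + \<bar>q E x - p E x\<bar> + \<bar>q D x - p D x\<bar>" for x
  proof -
    have "q E x * q D x - p E x * p D x = (q E x - p E x) * q D x + p E x * (q D x - p D x)"
      by (simp add: algebra_simps)
    moreover have "\<bar>(q E x - p E x) * q D x\<bar> \<le> \<bar>q E x - p E x\<bar>"
      "\<bar>p E x * (q D x - p D x)\<bar> \<le> \<bar>q D x - p D x\<bar>"
      using bounds by (simp_all add: abs_mult mult_left_le mult_left_le_one_le)
    ultimately show ?thesis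
      by linarith
  qed
  have "AE x in Q. \<bar>q (E \<inter> D) x - q E x * q D x\<bar> = 0"
    using indep AE_clipped_cond_prob_eq[OF Q HQ E[folded sets_eq]]
      AE_clipped_cond_prob_eq[OF Q HQ D[folded sets_eq]]
      AE_clipped_cond_prob_eq[OF Q HQ ED[folded sets_eq]]
    by eventually_elim (simp add: q_def)
  then have "(\<integral>x. \<bar>q (E \<inter> D) x - q E x * q D x\<bar> \<partial>Q) = 0"
    by (rule integral_eq_zero_AE)
  moreover have "\<bar>(\<integral>x. \<bar>q (E \<inter> D) x - q E x * q D x\<bar> \<partial>Q)
      - (\<integral>x. \<bar>q (E \<inter> D) x - q E x * q D x\<bar> \<partial>P)\<bar> \<le> tv_norm_diff Q P"
    using diff_le by (intro expectation_diff_le_tv_norm_diff[OF Q P sets_eq]) simp_all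
  ultimately have "(\<integral>x. \<bar>q (E \<inter> D) x - q E x * q D x\<bar> \<partial>P) \<le> tv_norm_diff Q P"
    by linarith
  moreover have "(\<integral>x. \<bar>p (E \<inter> D) x - p E x * p D x\<bar> \<partial>P)
    \<le> (\<integral>x. \<bar>q (E \<inter> D) x - p (E \<inter> D) x\<bar> + \<bar>q (E \<inter> D) x - q E x * q D x\<bar>
      + \<bar>q E x - p E x\<bar> + \<bar>q D x - p D x\<bar> \<partial>P)"
    using int triangle by (intro integral_mono) auto
  ultimately have "(\<integral>x. \<bar>p (E \<inter> D) x - p E x * p D x\<bar> \<partial>P) \<le> 7 * tv_norm_diff Q P"
    using int dist[OF E] dist[OF D] dist[OF ED] by simp
  then show ?thesis
    by (simp add: p_def)
qed

theorem theorem1: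
  fixes F :: "'a measure" and Pn :: "nat \<Rightarrow> 'a measure" and P :: "'a measure"
    and A B H :: "'a measure"
  assumes "\<And>n. n \<ge> 1 \<Longrightarrow> prob_space (Pn n)" and "\<And>n. n \<ge> 1 \<Longrightarrow> sets (Pn n) = sets F"
    and "prob_space P" and "sets P = sets F"
    and "converges_in_tv Pn P"
    and "subalgebra F A" and "subalgebra F B" and "subalgebra F H"
    and "\<And>n. n \<ge> 1 \<Longrightarrow> cond_indep_given (Pn n) A B H"
  shows "cond_indep_given P A B H"
  unfolding cond_indep_given_def
proof (intro ballI)
  fix E D assume EA: "E \<in> sets A" and DB: "D \<in> sets B"
  interpret P: prob_space P by fact
  have H: "subalgebra P H"
    using assms(4,8) sets_eq_imp_space_eq[OF assms(4)] by (simp add: subalgebra_def)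
  have E: "E \<in> sets P" and D: "D \<in> sets P"
    using EA DB assms(4,6,7) by (auto simp: subalgebra_def)
  then have ED: "E \<inter> D \<in> sets P"
    by blast
  define p where "p = clipped_cond_prob P H"
  define d where "d x = \<bar>p (E \<inter> D) x - p E x * p D x\<bar>" for x
  have [measurable]: "p G \<in> borel_measurable P" for G
    unfolding p_def using H measurable_clipped_cond_prob by (rule measurable_from_subalg)
  have bounds: "0 \<le> p G x" "p G x \<le> 1" "p G x * p G' x \<le> 1" "0 \<le> p G x * p G' x" for G G' x
    by (simp_all add: p_def clipped_cond_prob_bounds mult_le_one)
  have "d x \<le> 1" for x
    using bounds(1,2)[of "E \<inter> D" x] bounds(3,4)[of E x D] unfolding d_def by linarith
  moreover have "d \<in> borel_measurable P"
    unfolding d_def by measurable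
  ultimately have int: "integrable P d"
    by (intro P.integrable_const_bound[where B=1]) (simp_all add: d_def)
  have "(\<integral>x. d x \<partial>P) \<le> 7 * tv_norm_diff (Pn n) P" if "n \<ge> 1" for n
    unfolding d_def p_def
    using assms(1)[OF that] assms(2)[OF that] assms(9)[OF that] assms(3,4) H E D EA DB
    by (intro cond_indep_defect_le_tv_norm_diff) (auto simp: cond_indep_given_def)
  moreover have "(\<lambda>n. 7 * tv_norm_diff (Pn n) P) \<longlonglongrightarrow> 0"
    using assms(5) tendsto_mult_right_zero unfolding converges_in_tv_def by blast
  ultimately have "(\<integral>x. d x \<partial>P) \<le> 0"
    by (meson LIMSEQ_le_const)
  moreover have nonneg: "0 \<le> d x" for x
    by (simp add: d_def)
  then have "0 \<le> (\<integral>x. d x \<partial>P)"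
    by simp
  ultimately have "(\<integral>x. d x \<partial>P) = 0"
    by linarith
  then have "AE x in P. d x = 0"
    using integral_nonneg_eq_0_iff_AE[OF int] nonneg by simp
  then show "AE x in P. cond_prob_given P H (E \<inter> D) x
      = cond_prob_given P H E x * cond_prob_given P H D x"
    using AE_clipped_cond_prob_eq[OF assms(3) H E] AE_clipped_cond_prob_eq[OF assms(3) H D]
      AE_clipped_cond_prob_eq[OF assms(3) H ED]
    by eventually_elim (simp add: d_def p_def)
qed

end
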